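(* Let $t\le k$ be positive integers and $n,s\ge0$ integers. The number of words $w\in[k]^n$ with $\overleftarrow{\mathrm{des}}_{[t]}(w)=s$, which also equals the number of words $w\in[k]^n$ with $\overleftarrow{\mathrm{ris}}_{\{k+1-t,\ldots,k\}}(w)=s$, is $$\sum_{m=0}^n\sum_{a=0}^m\sum_{b=0}^{m-a}(-1)^{n-a-b-s}\binom{m}{a}\binom{m-a}{b}\binom{ta}{n-b}\binom{n-m}{s}(k-t)^b.$$
   Context: $[k]=\{1,\ldots,k\}$, $[k]^n$ is the set of words of length $n$ over $[k]$. For a word $w=w_1\cdots w_n$ and $X\subseteq\mathbb{N}$, $\overleftarrow{\mathrm{des}}_X(w)=|\{i:w_i>w_{i+1},\ w_i\in X\}|$ and $\overleftarrow{\mathrm{ris}}_X(w)=|\{i:w_i<w_{i+1},\ w_i\in X\}|$. Conventions: $\binom{a}{b}=0$ if $b<0$ or $b>a$ (for $a\ge0$), and $0^0=1$. *)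

theory Defs
  imports Complex_Main
begin

definition words :: "nat \<Rightarrow> nat \<Rightarrow> nat list set" where
  "words k n = {w. length w = n \<and> set w \<subseteq> {1..k}}"

(* List positions are 0-based: w ! i is the letter with index i + 1. *)

definition des_left :: "nat set \<Rightarrow> nat list \<Rightarrow> nat" where
  "des_left X w = card {i. Suc i < length w \<and> w ! i > w ! Suc i \<and> w ! i \<in> X}"

definition ris_left :: "nat set \<Rightarrow> nat list \<Rightarrow> nat" where
  "ris_left X w = card {i. Suc i < length w \<and> w ! i < w ! Suc i \<and> w ! i \<in> X}"

end

theory Submission
  imports
    Defs
    "HOL-Computational_Algebra.Formal_Power_Series"
    "HOL-Computational_Algebra.Polynomial"
begin

text \<open>Weight each word by \<open>z ^ des\<close>. Writing \<open>z = 1 + (z - 1)\<close> amounts to summing over all sets of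
  marked descents, each mark having weight \<open>z - 1\<close>. The marks cut a word into clusters, the
  maximal runs of letters joined by marked descents: a cluster is a single letter above \<open>t\<close>, or a
  nonempty subset of \<open>{1..t}\<close> written in decreasing order. Clusters are thus counted by
  \<open>g = (k - t) X + (1 + X) ^ t - 1\<close>, and a word of length \<open>n\<close> with \<open>m\<close> clusters has \<open>n - m\<close> marks,
  so the total weight is the sum over \<open>m\<close> of \<open>(z - 1) ^ (n - m)\<close> times the coefficient of \<open>X ^ n\<close>
  in \<open>g ^ m\<close>. Expanding both powers and taking the coefficient of \<open>z ^ s\<close> gives the formula. The
  rises are handled by the complement \<open>x \<mapsto> k + 1 - x\<close> on letters.\<close>

section \<open>Words and descents, split by the first letter\<close>

lemma words_0: "words k 0 = {[]}"
  by (auto simp: words_def)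

lemma words_Suc: "words k (Suc n) = (\<lambda>(c, w). c # w) ` ({1..k} \<times> words k n)"
  by (auto simp: words_def length_Suc_conv image_iff)

lemma finite_words [simp]: "finite (words k n)"
  by (induction n) (auto simp: words_0 words_Suc)

lemma sum_words_Suc:
  "(\<Sum>w\<in>words k (Suc n). f w) = (\<Sum>c=1..k. \<Sum>w\<in>words k n. f (c # w))"
proof -
  have "inj_on (\<lambda>(c, w). c # w) ({1..k} \<times> words k n)"
    by (auto simp: inj_on_def)
  then show ?thesis
    by (simp add: words_Suc sum.reindex sum.cartesian_product case_prod_unfold)
qed

lemma des_left_Nil: "des_left X [] = 0"
  by (simp add: des_left_def)

lemma des_left_Cons:
  "des_left X (c # w) = des_left X w + of_bool (w \<noteq> [] \<and> hd w < c \<and> c \<in> X)"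
proof -
  let ?D = "\<lambda>w. {i. Suc i < length w \<and> w ! i > w ! Suc i \<and> w ! i \<in> X}"
  have "?D (c # w) = Suc ` ?D w \<union> (if w \<noteq> [] \<and> hd w < c \<and> c \<in> X then {0} else {})"
    (is "?A = ?B")
  proof (rule set_eqI)
    show "i \<in> ?A \<longleftrightarrow> i \<in> ?B" for i
      by (cases i) (auto simp: hd_conv_nth)
  qed
  moreover have "finite (?D w)"
    by (rule finite_subset[of _ "{..length w}"]) auto
  ultimately show ?thesis
    by (auto simp: des_left_def card_image card_insert_if)
qed

section \<open>Weighted counts and the first cluster\<close>

definition des_gf :: "'a::comm_ring_1 \<Rightarrow> nat \<Rightarrow> nat \<Rightarrow> nat \<Rightarrow> 'a" where
  "des_gf z t k n = (\<Sum>w\<in>words k n. z ^ des_left {1..t} w)"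

lemma des_gf_0: "des_gf z t k 0 = 1"
  by (simp add: des_gf_def words_0 des_left_Nil)

lemma sum_choose_lessThan: "(\<Sum>d<n. d choose m) = n choose Suc m"
  by (induction n) simp_all

text \<open>The summand with index i collects the words whose first cluster has i letters after the
  first one.\<close>

lemma des_gf_first_letter:
  fixes z :: "'a::comm_ring_1"
  assumes "c < t" "t \<le> k"
  shows "(\<Sum>w\<in>words k n. z ^ des_left {1..t} (Suc c # w))
           = (\<Sum>i\<le>n. (z - 1) ^ i * of_nat (c choose i) * des_gf z t k (n - i))"
  using assms(1)
proof (induction n arbitrary: c)
  case 0
  then show ?case
    by (simp add: words_0 des_left_Cons des_left_Nil des_gf_0)
next
  case (Suc n)
  let ?F = "\<lambda>d. \<Sum>w\<in>words k n. z ^ des_left {1..t} (d # w)"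
  \<comment> \<open>A new descent has factor \<open>z = 1 + (z - 1)\<close>, unmarked or marked.
    Since \<open>c < t\<close>, the letter \<open>Suc c\<close> lies in \<open>{1..t}\<close>, so
    only \<open>d < Suc c\<close> has to be tested.\<close>
  have "(\<Sum>w\<in>words k (Suc n). z ^ des_left {1..t} (Suc c # w))
      = (\<Sum>d=1..k. \<Sum>w\<in>words k n. z ^ des_left {1..t} (d # w)
            + of_bool (d < Suc c) * ((z - 1) * z ^ des_left {1..t} (d # w)))"
    unfolding sum_words_Suc using Suc.prems
    by (intro sum.cong refl, subst des_left_Cons) (auto simp: algebra_simps)
  also have "\<dots> = des_gf z t k (Suc n) + (\<Sum>d=1..k. of_bool (d < Suc c) * ((z - 1) * ?F d))"
    by (simp add: des_gf_def sum_words_Suc sum.distrib sum_distrib_left)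
  also have "(\<Sum>d=1..k. of_bool (d < Suc c) * ((z - 1) * ?F d)) = (\<Sum>d\<in>Suc ` {..<c}. (z - 1) * ?F d)"
    using Suc.prems assms(2)
    by (intro sum.mono_neutral_cong_right) (auto simp: image_iff less_Suc_eq_0_disj Suc_le_eq gr0_conv_Suc)
  also have "\<dots> = (\<Sum>d<c. (z - 1) * ?F (Suc d))"
    by (simp add: sum.reindex)
  \<comment> \<open>A marked descent continues the cluster: the induction hypothesis applies at the
    next letter \<open>Suc d\<close>, with one more mark.\<close>
  also have "\<dots> = (\<Sum>d<c. \<Sum>i\<le>n. (z - 1) ^ Suc i * of_nat (d choose i) * des_gf z t k (n - i))"
    using Suc.prems by (intro sum.cong refl, subst Suc.IH) (simp_all add: sum_distrib_left mult_ac)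
  \<comment> \<open>Hockey-stick identity: the next letter is the largest of the
    \<open>Suc i\<close> letters chosen below the first.\<close>
  also have "\<dots> = (\<Sum>i\<le>n. (z - 1) ^ Suc i * of_nat (c choose Suc i) * des_gf z t k (n - i))"
    by (subst sum.swap)
       (simp add: sum_choose_lessThan[symmetric] sum_distrib_left sum_distrib_right)
  \<comment> \<open>The unmarked case supplies the term \<open>i = 0\<close>, where the first letter
    is a cluster by itself.\<close>
  also have "des_gf z t k (Suc n) + \<dots>
      = (\<Sum>i\<le>Suc n. (z - 1) ^ i * of_nat (c choose i) * des_gf z t k (Suc n - i))"
    by (subst sum.atMost_Suc_shift) simp
  finally show ?case .
qed

section \<open>Powers of the cluster series\<close>

unbundle fps_syntax

definition cluster_fps :: "nat \<Rightarrow> nat \<Rightarrow> 'a::comm_ring_1 fps" where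
  "cluster_fps t k = of_nat (k - t) * fps_X + ((1 + fps_X) ^ t - 1)"

lemma fps_nth_one_plus_X_power:
  "((1 + fps_X) ^ n :: 'a::comm_ring_1 fps) $ i = of_nat (n choose i)"
proof -
  have "((1 + fps_X) ^ n :: 'a fps) $ i = (\<Sum>j\<le>n. of_nat (n choose j) * (if i = j then 1 else 0))"
    by (simp add: add.commute[of 1] binomial_ring fps_sum_nth fps_mult_of_nat_nth)
  also have "\<dots> = of_nat (n choose i)"
    by (simp add: if_distrib binomial_eq_0 cong: if_cong)
  finally show ?thesis .
qed

lemma cluster_fps_nth_0: "cluster_fps t k $ 0 = 0"
  by (simp add: cluster_fps_def fps_mult_of_nat_nth fps_nth_one_plus_X_power)

lemma cluster_fps_nth_Suc:
  "cluster_fps t k $ Suc i = of_bool (i = 0) * of_nat (k - t) + of_nat (t choose Suc i)"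
  by (simp add: cluster_fps_def fps_mult_of_nat_nth fps_nth_one_plus_X_power)

text \<open>Removing the first cluster, which has \<open>Suc i\<close> letters and \<open>i\<close>
  marks, leaves an arbitrary word of length \<open>n - i\<close>.\<close>

lemma des_gf_Suc:
  fixes z :: "'a::comm_ring_1"
  assumes "t \<le> k"
  shows "des_gf z t k (Suc n)
           = (\<Sum>i\<le>n. (z - 1) ^ i * cluster_fps t k $ Suc i * des_gf z t k (n - i))"
proof -
  let ?F = "\<lambda>c. \<Sum>w\<in>words k n. z ^ des_left {1..t} (c # w)"
  have split: "{1..k} = Suc ` {..<t} \<union> {Suc t..k}"
    using assms by (auto simp: image_Suc_lessThan)
  have "des_gf z t k (Suc n) = (\<Sum>c=1..k. ?F c)"
    by (simp add: des_gf_def sum_words_Suc)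
  also have "\<dots> = (\<Sum>c<t. ?F (Suc c)) + (\<Sum>c=Suc t..k. ?F c)"
    unfolding split by (subst sum.union_disjoint) (auto simp: sum.reindex)
  \<comment> \<open>A letter above \<open>t\<close> never starts a counted descent; it is an
    unmarked cluster and enters only at \<open>i = 0\<close>.\<close>
  also have "(\<Sum>c=Suc t..k. ?F c) = of_nat (k - t) * des_gf z t k n"
    by (simp add: des_left_Cons des_gf_def)
  also have "\<dots> = (\<Sum>i\<le>n. (z - 1) ^ i * (of_bool (i = 0) * of_nat (k - t)) * des_gf z t k (n - i))"
    by (simp add: of_bool_def if_distrib if_distribR cong: if_cong)
  also have "(\<Sum>c<t. ?F (Suc c))
      = (\<Sum>c<t. \<Sum>i\<le>n. (z - 1) ^ i * of_nat (c choose i) * des_gf z t k (n - i))"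
    using assms by (intro sum.cong refl des_gf_first_letter) simp_all
  \<comment> \<open>Hockey-stick identity over the largest letter \<open>Suc c\<close> of the
    cluster.\<close>
  also have "\<dots> = (\<Sum>i\<le>n. (z - 1) ^ i * of_nat (t choose Suc i) * des_gf z t k (n - i))"
    by (subst sum.swap)
       (simp add: sum_choose_lessThan[symmetric] sum_distrib_left sum_distrib_right)
  finally show ?thesis
    by (simp add: cluster_fps_nth_Suc sum.distrib[symmetric] algebra_simps)
qed

text \<open>Both sides obey the first-cluster recurrence: on the right, one factor of the power is
  the first cluster.\<close>

lemma des_gf_eq:
  fixes z :: "'a::comm_ring_1"
  assumes "t \<le> k"
  shows "des_gf z t k n = (\<Sum>m\<le>n. (z - 1) ^ (n - m) * (cluster_fps t k ^ m) $ n)"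
proof (induction n rule: less_induct)
  case (less n)
  let ?g = "cluster_fps t k :: 'a fps"
  show ?case
  proof (cases n)
    case 0
    then show ?thesis by (simp add: des_gf_0)
  next
    case (Suc N)
    have power_nth: "(?g ^ Suc m) $ Suc N = (\<Sum>i\<le>N. ?g $ Suc i * (?g ^ m) $ (N - i))" for m
      by (simp add: fps_mult_nth atMost_atLeast0[symmetric] sum.atMost_Suc_shift cluster_fps_nth_0
            del: sum.atMost_Suc)
    \<comment> \<open>\<open>m\<close> nonempty clusters need at least \<open>m\<close>
      letters.\<close>
    have vanish: "(?g ^ m) $ j = 0" if "j < m" for m j
      using startsby_zero_power_prefix[OF cluster_fps_nth_0] that by blast
    have "(\<Sum>m\<le>Suc N. (z - 1) ^ (Suc N - m) * (?g ^ m) $ Suc N)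
        = (\<Sum>m\<le>N. (z - 1) ^ (N - m) * (?g ^ Suc m) $ Suc N)"
      by (subst sum.atMost_Suc_shift) simp
    also have "\<dots> = (\<Sum>m\<le>N. \<Sum>i\<le>N. (z - 1) ^ (N - m) * (?g $ Suc i * (?g ^ m) $ (N - i)))"
      by (simp only: power_nth sum_distrib_left)
    also have "\<dots> = (\<Sum>i\<le>N. \<Sum>m\<le>N. (z - 1) ^ (N - m) * (?g $ Suc i * (?g ^ m) $ (N - i)))"
      by (rule sum.swap)
    \<comment> \<open>The \<open>N - m\<close> marks split into \<open>i\<close> in the first
      cluster and the rest; terms with \<open>m > N - i\<close> vanish.\<close>
    also have "\<dots> = (\<Sum>i\<le>N. \<Sum>m\<le>N - i. (z - 1) ^ i * ?g $ Suc i
                              * ((z - 1) ^ (N - i - m) * (?g ^ m) $ (N - i)))"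
    proof (rule sum.cong[OF refl], rule sum.mono_neutral_cong_right)
      fix i m assume "i \<in> {..N}" "m \<in> {..N - i}"
      then have "N - m = i + (N - i - m)" by auto
      then have "(z - 1) ^ (N - m) = (z - 1) ^ i * (z - 1) ^ (N - i - m)"
        by (metis power_add)
      then show "(z - 1) ^ (N - m) * (?g $ Suc i * (?g ^ m) $ (N - i))
          = (z - 1) ^ i * ?g $ Suc i * ((z - 1) ^ (N - i - m) * (?g ^ m) $ (N - i))"
        by (simp add: mult_ac)
    qed (auto simp: vanish)
    also have "\<dots> = (\<Sum>i\<le>N. (z - 1) ^ i * ?g $ Suc i * des_gf z t k (N - i))"
      using less.IH Suc by (intro sum.cong) (simp_all add: sum_distrib_left)
    also have "\<dots> = des_gf z t k (Suc N)"
      using assms by (simp add: des_gf_Suc)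
    finally show ?thesis using Suc by simp
  qed
qed

text \<open>Among the \<open>m\<close> factors, \<open>a\<close> contribute
  \<open>(1 + X) ^ t\<close>, \<open>b\<close> contribute \<open>(k - t) X\<close>, and the others
  \<open>-1\<close>. As \<open>b \<le> m \<le> n\<close>, the subtraction \<open>n - b\<close> is
  exact.\<close>

lemma cluster_fps_power_nth:
  assumes "m \<le> n"
  shows "(cluster_fps t k ^ m :: 'a::comm_ring_1 fps) $ n
     = (\<Sum>a\<le>m. \<Sum>b\<le>m - a. (- 1) ^ (m - a - b) * of_nat ((m choose a) * ((m - a) choose b)
          * ((t * a) choose (n - b)) * (k - t) ^ b))"
proof -
  let ?Y = "(1 + fps_X) ^ t :: 'a fps" and ?V = "of_nat (k - t) * fps_X :: 'a fps"
  have "cluster_fps t k ^ m = (?Y + (?V + (- 1))) ^ m"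
    by (simp add: cluster_fps_def algebra_simps)
  also have "\<dots> = (\<Sum>a\<le>m. of_nat (m choose a) * ?Y ^ a * (?V + (- 1)) ^ (m - a))"
    by (rule binomial_ring)
  also have "\<dots> = (\<Sum>a\<le>m. of_nat (m choose a) * ?Y ^ a
        * (\<Sum>b\<le>m - a. of_nat ((m - a) choose b) * ?V ^ b * (- 1) ^ (m - a - b)))"
    by (simp only: binomial_ring)
  also have "\<dots> = (\<Sum>a\<le>m. \<Sum>b\<le>m - a. fps_const ((- 1) ^ (m - a - b)
        * of_nat ((m choose a) * ((m - a) choose b) * (k - t) ^ b))
        * (fps_X ^ b * (1 + fps_X) ^ (t * a)))"
    by (simp add: sum_distrib_left power_mult[symmetric] power_mult_distrib fps_of_nat[symmetric]
          fps_const_neg[symmetric] fps_const_mult[symmetric] fps_const_power[symmetric] mult_ac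
          del: fps_const_mult fps_const_power fps_const_neg)
  finally have "(cluster_fps t k ^ m :: 'a fps) $ n = (\<Sum>a\<le>m. \<Sum>b\<le>m - a. (- 1) ^ (m - a - b)
        * of_nat ((m choose a) * ((m - a) choose b) * (k - t) ^ b)
        * of_nat ((t * a) choose (n - b)))"
    using assms
    by (simp only: fps_sum_nth fps_mult_left_const_nth fps_X_power_mult_nth)
       (intro sum.cong refl, simp add: fps_nth_one_plus_X_power)
  then show ?thesis
    by (simp only: of_nat_mult mult_ac)
qed

section \<open>Extracting the coefficient of \<open>z ^ s\<close>\<close>

lemma coeff_X_minus_1_power:
  "coeff ((monom 1 1 - 1 :: real poly) ^ j) s = (- 1) powi (int j - int s) * of_nat (j choose s)"
proof -
  have "(monom 1 1 - 1 :: real poly) ^ j = (\<Sum>i\<le>j. monom (of_nat (j choose i) * (- 1) ^ (j - i)) i)"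
    unfolding diff_conv_add_uminus binomial_ring
    by (intro sum.cong refl)
       (simp add: monom_power of_nat_poly minus_one_power_iff monom_altdef)
  then have "coeff ((monom 1 1 - 1 :: real poly) ^ j) s
      = (\<Sum>i\<le>j. if i = s then of_nat (j choose i) * (- 1) ^ (j - i) else 0)"
    by (simp add: coeff_sum)
  also have "\<dots> = (if s \<le> j then of_nat (j choose s) * (- 1) ^ (j - s) else 0)"
    by simp
  \<comment> \<open>For \<open>s > j\<close> the exponent is negative, but the binomial coefficient
    is zero.\<close>
  also have "\<dots> = (- 1) powi (int j - int s) * of_nat (j choose s)"
    by (auto simp: power_int_def nat_diff_distrib)
  finally show ?thesis .
qed

text \<open>Here \<open>z\<close> becomes the polynomial variable \<open>monom 1 1\<close>, so words
  are sorted by their number of descents.\<close>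

lemma card_des_eq_coeff:
  "real (card {w \<in> words k n. des_left {1..t} w = s}) = coeff (des_gf (monom 1 1) t k n) s"
  by (simp add: des_gf_def coeff_sum monom_power sum.If_cases Int_def)

section \<open>Rises by complementing letters\<close>

lemma ris_left_complement:
  assumes "w \<in> words k n" "t \<le> k"
  shows "ris_left {k + 1 - t..k} (map (\<lambda>x. k + 1 - x) w) = des_left {1..t} w"
proof -
  let ?c = "map (\<lambda>x. k + 1 - x)"
  \<comment> \<open>On letters in \<open>{1..k}\<close> the truncated subtraction
    \<open>k + 1 - x\<close> is exact, hence strictly order-reversing.\<close>
  have bound: "1 \<le> w ! i \<and> w ! i \<le> k" if "i < length w" for i
    using assms(1) nth_mem[OF that] by (auto simp: words_def)
  show ?thesis
    unfolding ris_left_def des_left_def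
  proof (intro arg_cong[of _ _ card] Collect_cong)
    show "(Suc i < length (?c w) \<and> ?c w ! i < ?c w ! Suc i \<and> ?c w ! i \<in> {k + 1 - t..k})
        \<longleftrightarrow> (Suc i < length w \<and> w ! Suc i < w ! i \<and> w ! i \<in> {1..t})" for i
      using bound[of i] bound[of "Suc i"] assms(2) by auto
  qed
qed

text \<open>The complement is an involution on words that exchanges the two statistics.\<close>

lemma card_ris_eq_card_des:
  assumes "t \<le> k"
  shows "card {w \<in> words k n. ris_left {k + 1 - t..k} w = s}
           = card {w \<in> words k n. des_left {1..t} w = s}"
proof -
  let ?c = "map (\<lambda>x. k + 1 - x)"
  have inv: "?c (?c w) = w" if "w \<in> words k n" for w
    using that by (auto simp: words_def intro!: map_idI)
  have closed: "?c w \<in> words k n" if "w \<in> words k n" for w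
    using that by (fastforce simp: words_def)
  have des: "des_left {1..t} (?c w) = ris_left {k + 1 - t..k} w" if "w \<in> words k n" for w
    using ris_left_complement[OF closed[OF that] assms] inv[OF that] by simp
  have "bij_betw ?c {w \<in> words k n. des_left {1..t} w = s}
          {w \<in> words k n. ris_left {k + 1 - t..k} w = s}"
    by (rule bij_betw_byWitness[where f' = ?c])
       (use inv closed des ris_left_complement[OF _ assms] in \<open>auto simp del: map_map One_nat_def\<close>)
  then show ?thesis
    by (simp add: bij_betw_same_card)
qed

section \<open>Both counts in closed form\<close>

theorem theorem4p1:
  fixes t k n s :: nat
  assumes "1 \<le> t" and "t \<le> k"
  shows "card {w \<in> words k n. des_left {1..t} w = s}
           = card {w \<in> words k n. ris_left {k + 1 - t..k} w = s}
       \<and> real (card {w \<in> words k n. des_left {1..t} w = s})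
           = (\<Sum>m = 0..n. \<Sum>a = 0..m. \<Sum>b = 0..m - a.
                (- 1) powi (int n - int a - int b - int s)
                * real (m choose a) * real ((m - a) choose b)
                * real ((t * a) choose (n - b)) * real ((n - m) choose s)
                * (real k - real t) ^ b)"
proof
  show "card {w \<in> words k n. des_left {1..t} w = s}
      = card {w \<in> words k n. ris_left {k + 1 - t..k} w = s}"
    by (rule card_ris_eq_card_des[OF assms(2), symmetric])
  let ?N = "\<lambda>m a b. (m choose a) * ((m - a) choose b) * ((t * a) choose (n - b)) * (k - t) ^ b"
  let ?y = "monom 1 1 - 1 :: real poly"
  have term_eq: "coeff (?y ^ (n - m) * ((- 1) ^ (m - a - b) * of_nat (?N m a b))) s
      = (- 1) powi (int n - int a - int b - int s)
                * real (m choose a) * real ((m - a) choose b)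
                * real ((t * a) choose (n - b)) * real ((n - m) choose s)
                * (real k - real t) ^ b"
    if "m \<le> n" "a \<le> m" "b \<le> m - a" for m a b
  proof -
    have "?y ^ (n - m) * ((- 1) ^ (m - a - b) * of_nat (?N m a b))
        = smult ((- 1) ^ (m - a - b) * of_nat (?N m a b)) (?y ^ (n - m))"
      by (cases "even (m - a - b)") (simp_all add: of_nat_poly mult.commute del: of_nat_mult of_nat_power)
    moreover have "(- 1) powi (int n - int a - int b - int s)
        = ((- 1) ^ (m - a - b) * (- 1) powi (int (n - m) - int s) :: real)"
    proof -
      \<comment> \<open>The sign of the cluster expansion and that of the coefficient of
        \<open>(z - 1) ^ (n - m)\<close> combine, and \<open>m\<close> cancels.\<close>
      have "int n - int a - int b - int s = int (m - a - b) + (int (n - m) - int s)"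
        using that by simp
      then show ?thesis
        by (simp only: power_int_add power_int_of_nat simp_thms neg_equal_0_iff_equal one_neq_zero)
    qed
    ultimately show ?thesis
      using assms by (simp add: coeff_X_minus_1_power del: One_nat_def)
  qed
  show "real (card {w \<in> words k n. des_left {1..t} w = s})
      = (\<Sum>m = 0..n. \<Sum>a = 0..m. \<Sum>b = 0..m - a.
                (- 1) powi (int n - int a - int b - int s)
                * real (m choose a) * real ((m - a) choose b)
                * real ((t * a) choose (n - b)) * real ((n - m) choose s)
                * (real k - real t) ^ b)"
    unfolding card_des_eq_coeff des_gf_eq[OF assms(2)] atLeast0AtMost coeff_sum
  proof (intro sum.cong refl)
    fix m assume "m \<in> {..n}"
    then have "m \<le> n" by simp
    show "coeff (?y ^ (n - m) * (cluster_fps t k ^ m) $ n) s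
        = (\<Sum>a\<le>m. \<Sum>b\<le>m - a. (- 1) powi (int n - int a - int b - int s)
                * real (m choose a) * real ((m - a) choose b)
                * real ((t * a) choose (n - b)) * real ((n - m) choose s)
                * (real k - real t) ^ b)"
      unfolding cluster_fps_power_nth[OF \<open>m \<le> n\<close>] sum_distrib_left coeff_sum
      using \<open>m \<le> n\<close> by (intro sum.cong refl term_eq) simp_all
  qed
qed

end
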